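(* Let $(X,d)$ be a compact metric space that is not quasihypermetric. Then $M(X)=\infty$.
   Context: A metric space $(X,d)$ is called quasihypermetric if for all $n\in\mathbb{N}$, all $\alpha_1,\dots,\alpha_n\in\mathbb{R}$ with $\sum_{i=1}^n\alpha_i=0$ and all $x_1,\dots,x_n\in X$ one has $\sum_{i,j=1}^n\alpha_i\alpha_j d(x_i,x_j)\le 0$. For a compact metric space $(X,d)$, let $\mathcal{M}(X)$ be the space of all finite signed Borel measures on $X$ and $\mathcal{M}_1(X)$ the set of those of total mass $1$ (i.e. $\mu(X)=1$). For $\mu\in\mathcal{M}(X)$ put $I(\mu)=\int_X\int_X d(x,y)\,d\mu(x)\,d\mu(y)$, and let $M(X)=\sup\{I(\mu):\mu\in\mathcal{M}_1(X)\}\in(-\infty,\infty]$. *)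

theory Defs
  imports "HOL-Analysis.Analysis"
begin

definition quasihypermetric :: "'a set \<Rightarrow> ('a \<Rightarrow> 'a \<Rightarrow> real) \<Rightarrow> bool" where
  "quasihypermetric X d \<longleftrightarrow>
     (\<forall>(n::nat) (\<alpha> :: nat \<Rightarrow> real) (x :: nat \<Rightarrow> 'a).
        (\<Sum>i=1..n. \<alpha> i) = 0 \<longrightarrow> (\<forall>i\<in>{1..n}. x i \<in> X) \<longrightarrow>
        (\<Sum>i=1..n. \<Sum>j=1..n. \<alpha> i * \<alpha> j * d (x i) (x j)) \<le> 0)"

definition metric_borel :: "'a set \<Rightarrow> ('a \<Rightarrow> 'a \<Rightarrow> real) \<Rightarrow> 'a measure" where
  "metric_borel X d = sigma X {U. openin (Metric_space.mtopology X d) U}"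

text \<open>
  A finite signed measure is a countably additive real-valued set function on the measurable sets
  of \<open>N\<close>.  Only \<open>space N\<close> and \<open>sets N\<close> are used, and the values of \<open>\<mu>\<close> outside \<open>sets N\<close> are irrelevant.
\<close>

definition finite_signed_measure :: "'a measure \<Rightarrow> ('a set \<Rightarrow> real) \<Rightarrow> bool" where
  "finite_signed_measure N \<mu> \<longleftrightarrow>
     \<mu> {} = 0 \<and>
     (\<forall>A :: nat \<Rightarrow> 'a set. range A \<subseteq> sets N \<longrightarrow> disjoint_family A \<longrightarrow>
        (\<lambda>i. \<mu> (A i)) sums \<mu> (\<Union>i. A i))"

text \<open>
  The Jordan decomposition \<open>\<mu> = \<mu>\<^sup>+ - \<mu>\<^sup>-\<close>: the upper variation is
  \<open>\<mu>\<^sup>+(A) = sup {\<mu>(B) | B \<subseteq> A measurable}\<close>, and \<open>\<mu>\<^sup>-\<close> is the upper variation of \<open>-\<mu>\<close>.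
  Truncating negative values of \<open>\<mu>(B)\<close> at \<open>0\<close> by \<open>ennreal\<close> is harmless, as \<open>B = {}\<close> contributes \<open>0\<close>.
  By the Hahn decomposition theorem both variations are finite measures, so bounded measurable
  functions (in particular \<open>d\<close> on a compact space) are integrable with respect to both.
  The lemma \<open>emeasure_upper_variation\<close> below shows that \<open>measure_of\<close> does not degenerate to
  the null measure.
\<close>

definition upper_variation :: "'a measure \<Rightarrow> ('a set \<Rightarrow> real) \<Rightarrow> 'a measure" where
  "upper_variation N \<mu> =
     measure_of (space N) (sets N) (\<lambda>A. SUP B \<in> {B \<in> sets N. B \<subseteq> A}. ennreal (\<mu> B))"

definition lower_variation :: "'a measure \<Rightarrow> ('a set \<Rightarrow> real) \<Rightarrow> 'a measure" where
  "lower_variation N \<mu> = upper_variation N (\<lambda>A. - \<mu> A)"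

definition signed_integral :: "'a measure \<Rightarrow> ('a set \<Rightarrow> real) \<Rightarrow> ('a \<Rightarrow> real) \<Rightarrow> real" where
  "signed_integral N \<mu> f =
     (\<integral>x. f x \<partial>upper_variation N \<mu>) - (\<integral>x. f x \<partial>lower_variation N \<mu>)"

lemma finite_signed_measure_finite_sum:
  assumes "finite_signed_measure N \<mu>" "finite I"
    and "\<And>i::nat. i \<in> I \<Longrightarrow> A i \<in> sets N" "disjoint_family_on A I"
  shows "\<mu> (\<Union>i\<in>I. A i) = (\<Sum>i\<in>I. \<mu> (A i))"
proof -
  define A' where "A' = (\<lambda>i. if i \<in> I then A i else {})"
  have e: "\<mu> {} = 0" using assms(1) by (simp add: finite_signed_measure_def)
  have "range A' \<subseteq> sets N" using assms(3) by (auto simp: A'_def)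
  moreover have "disjoint_family A'"
    using assms(4) by (auto simp: A'_def disjoint_family_on_def)
  ultimately have "(\<lambda>i. \<mu> (A' i)) sums \<mu> (\<Union>i. A' i)"
    using assms(1) by (simp add: finite_signed_measure_def)
  moreover have "(\<lambda>i. \<mu> (A' i)) sums (\<Sum>i\<in>I. \<mu> (A' i))"
    by (rule sums_finite) (auto simp: A'_def e assms(2))
  ultimately have "\<mu> (\<Union>i. A' i) = (\<Sum>i\<in>I. \<mu> (A' i))" by (rule sums_unique2)
  moreover have "(\<Union>i. A' i) = (\<Union>i\<in>I. A i)" by (auto simp: A'_def split: if_splits)
  moreover have "(\<Sum>i\<in>I. \<mu> (A' i)) = (\<Sum>i\<in>I. \<mu> (A i))" by (simp add: A'_def)
  ultimately show ?thesis by simp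
qed

lemma countably_additive_upper_variation:
  assumes \<mu>: "finite_signed_measure N \<mu>"
  shows "countably_additive (sets N) (\<lambda>A. SUP B \<in> {B \<in> sets N. B \<subseteq> A}. ennreal (\<mu> B))"
    (is "countably_additive _ ?v")
proof (rule countably_additiveI)
  fix A :: "nat \<Rightarrow> 'a set"
  assume A: "range A \<subseteq> sets N" "disjoint_family A"
  have e: "\<mu> {} = 0" using \<mu> by (simp add: finite_signed_measure_def)
  have ub: "ennreal (\<mu> B) \<le> ?v C" if "B \<in> sets N" "B \<subseteq> C" for B C
    using that by (intro SUP_upper) auto
  have "?v (\<Union>i. A i) \<le> (\<Sum>i. ?v (A i))"
  proof (rule SUP_least)
    fix B assume "B \<in> {B \<in> sets N. B \<subseteq> (\<Union>i. A i)}"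
    then have B: "B \<in> sets N" "B = (\<Union>i. B \<inter> A i)" by auto
    have "range (\<lambda>i. B \<inter> A i) \<subseteq> sets N" using A B(1) by auto
    moreover have "disjoint_family (\<lambda>i. B \<inter> A i)"
      using A(2) by (auto simp: disjoint_family_on_def)
    ultimately have "(\<lambda>i. \<mu> (B \<inter> A i)) sums \<mu> B"
      using \<mu> B(2) unfolding finite_signed_measure_def by metis
    then have lim: "(\<lambda>n. ennreal (\<Sum>i<n. \<mu> (B \<inter> A i))) \<longlonglongrightarrow> ennreal (\<mu> B)"
      unfolding sums_def by (rule tendsto_ennrealI)
    show "ennreal (\<mu> B) \<le> (\<Sum>i. ?v (A i))"
    proof (rule LIMSEQ_le_const2[OF lim], intro exI allI impI)
      fix n
      have "ennreal (\<Sum>i<n. \<mu> (B \<inter> A i)) \<le> ennreal (\<Sum>i<n. max 0 (\<mu> (B \<inter> A i)))"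
        by (intro ennreal_leI sum_mono) simp
      also have "\<dots> = (\<Sum>i<n. ennreal (\<mu> (B \<inter> A i)))"
        by (subst sum_ennreal[symmetric]) (auto simp: max_def ennreal_neg simp del: sum_ennreal intro!: sum.cong)
      also have "\<dots> \<le> (\<Sum>i<n. ?v (A i))"
        using A B(1) by (intro sum_mono ub) auto
      also have "\<dots> \<le> (\<Sum>i. ?v (A i))" by (rule sum_le_suminf) auto
      finally show "ennreal (\<Sum>i<n. \<mu> (B \<inter> A i)) \<le> (\<Sum>i. ?v (A i))" .
    qed
  qed
  moreover have "(\<Sum>i. ?v (A i)) \<le> ?v (\<Union>i. A i)"
  proof (rule suminf_le_const)
    have pair: "?v S + ?v T \<le> ?v (S \<union> T)" if "S \<inter> T = {}" for S T
    proof -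
      have step: "ennreal (\<mu> B) + ennreal (\<mu> C) \<le> ?v (S \<union> T)"
        if "B \<in> sets N" "B \<subseteq> S" "C \<in> sets N" "C \<subseteq> T" for B C
      proof (cases "0 \<le> \<mu> B \<and> 0 \<le> \<mu> C")
        case True
        have "\<mu> (\<Union>i\<in>{0,1::nat}. if i = 0 then B else C)
              = (\<Sum>i\<in>{0,1::nat}. \<mu> (if i = 0 then B else C))"
          using that \<open>S \<inter> T = {}\<close>
          by (intro finite_signed_measure_finite_sum[OF \<mu>]) (auto simp: disjoint_family_on_def)
        then have "\<mu> (B \<union> C) = \<mu> B + \<mu> C" by (simp add: Un_commute)
        then have "ennreal (\<mu> B) + ennreal (\<mu> C) = ennreal (\<mu> (B \<union> C))"
          using True by (simp add: ennreal_plus)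
        also have "\<dots> \<le> ?v (S \<union> T)" using that by (intro ub) auto
        finally show ?thesis .
      next
        case False
        have "ennreal (\<mu> B) \<le> ?v (S \<union> T)" "ennreal (\<mu> C) \<le> ?v (S \<union> T)"
          by (rule ub; use that in blast)+
        moreover have "ennreal (\<mu> B) = 0 \<or> ennreal (\<mu> C) = 0"
          using False by (meson ennreal_neg linear)
        ultimately show ?thesis
          by (elim disjE) (simp_all only: add_0_left add_0_right)
      qed
      have ne: "{B \<in> sets N. B \<subseteq> U} \<noteq> {}" for U by auto
      have left: "?v S + ennreal (\<mu> C) \<le> ?v (S \<union> T)" if "C \<in> sets N" "C \<subseteq> T" for C
        by (subst ennreal_SUP_add_left[OF ne, symmetric], rule SUP_least, rule step)
          (use that in blast)+
      show ?thesis
        by (subst ennreal_SUP_add_right[OF ne], rule SUP_least, rule left) blast+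
    qed
    fix n
    have "(\<Sum>i<n. ?v (A i)) \<le> ?v (\<Union>i<n. A i)"
    proof (induction n)
      case (Suc n)
      have "(\<Union>i<n. A i) \<inter> A n = {}"
        using disjoint_family_onD[OF A(2)] by (metis UNIV_I disjoint_iff UN_E lessThan_iff less_irrefl)
      have "(\<Sum>i<Suc n. ?v (A i)) \<le> ?v (\<Union>i<n. A i) + ?v (A n)"
        unfolding sum.lessThan_Suc by (rule add_right_mono[OF Suc.IH])
      also have "\<dots> \<le> ?v ((\<Union>i<n. A i) \<union> A n)" by (rule pair) fact
      also have "(\<Union>i<n. A i) \<union> A n = (\<Union>i<Suc n. A i)"
        unfolding lessThan_Suc by blast
      finally show ?case .
    next
      case 0
      show ?case by (simp only: lessThan_0 sum.empty zero_le)
    qed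
    also have "\<dots> \<le> ?v (\<Union>i. A i)" by (rule SUP_subset_mono) auto
    finally show "(\<Sum>i<n. ?v (A i)) \<le> ?v (\<Union>i. A i)" .
  qed simp
  ultimately show "(\<Sum>i. ?v (A i)) = ?v (\<Union>i. A i)" by (rule antisym[rotated])
qed

lemma emeasure_upper_variation:
  assumes "finite_signed_measure N \<mu>" "A \<in> sets N"
  shows "emeasure (upper_variation N \<mu>) A = (SUP B \<in> {B \<in> sets N. B \<subseteq> A}. ennreal (\<mu> B))"
proof -
  have "\<mu> {} = 0" using assms(1) by (simp add: finite_signed_measure_def)
  then have "positive (sets N) (\<lambda>A. SUP B \<in> {B \<in> sets N. B \<subseteq> A}. ennreal (\<mu> B))"
    by (auto simp: positive_def cong: conj_cong)
  with assms show ?thesis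
    unfolding upper_variation_def
    by (intro emeasure_measure_of_sigma countably_additive_upper_variation sets.sigma_algebra_axioms)
qed

definition energy :: "'a set \<Rightarrow> ('a \<Rightarrow> 'a \<Rightarrow> real) \<Rightarrow> ('a set \<Rightarrow> real) \<Rightarrow> real" where
  "energy X d \<mu> =
     signed_integral (metric_borel X d) \<mu> (\<lambda>y. signed_integral (metric_borel X d) \<mu> (\<lambda>x. d x y))"

definition unit_signed_measures :: "'a set \<Rightarrow> ('a \<Rightarrow> 'a \<Rightarrow> real) \<Rightarrow> ('a set \<Rightarrow> real) set" where
  "unit_signed_measures X d = {\<mu>. finite_signed_measure (metric_borel X d) \<mu> \<and> \<mu> X = 1}"

definition max_energy :: "'a set \<Rightarrow> ('a \<Rightarrow> 'a \<Rightarrow> real) \<Rightarrow> ereal" where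
  "max_energy X d = (SUP \<mu> \<in> unit_signed_measures X d. ereal (energy X d \<mu>))"

end

theory Submission
  imports Defs
begin

text \<open>
  Choose a finitely supported signed measure \<open>\<nu>\<close> of total mass \<open>0\<close> with \<open>I(\<nu>) > 0\<close>.  For a point
  \<open>p\<close> of its support, \<open>t\<nu> + \<delta>\<^sub>p\<close> has total mass \<open>1\<close>, and its energy is a quadratic polynomial in \<open>t\<close>
  with leading coefficient \<open>I(\<nu>) > 0\<close>, hence unbounded.
\<close>

definition discrete_measure :: "'a set \<Rightarrow> ('a \<Rightarrow> real) \<Rightarrow> 'a set \<Rightarrow> real" where
  "discrete_measure S c A = (\<Sum>s\<in>S. c s * indicator A s)"

lemma finite_signed_measure_discrete:
  "finite_signed_measure N (discrete_measure S c)"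
  unfolding finite_signed_measure_def discrete_measure_def
proof (intro conjI allI impI)
  fix A :: "nat \<Rightarrow> 'a set"
  assume "disjoint_family A"
  then have "(\<lambda>i. indicator (A i) s) sums (indicator (\<Union>i. A i) s :: real)" for s
    by (intro indicator_sums) (auto simp: disjoint_family_on_def)
  then show "(\<lambda>i. \<Sum>s\<in>S. c s * indicator (A i) s) sums (\<Sum>s\<in>S. c s * indicator (\<Union>i. A i) s)"
    by (intro sums_sum sums_mult)
qed simp

lemma sets_upper_variation [simp, measurable_cong]: "sets (upper_variation N \<mu>) = sets N"
  by (simp add: upper_variation_def)

lemma ennreal_max_zero: "ennreal (max 0 x) = ennreal x"
  by (cases "0 \<le> x") (auto simp: max_def ennreal_neg)

text \<open>The supremum over measurable subsets of \<open>A\<close> is attained by the points of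
  \<open>S\<close> in \<open>A\<close> with positive weight. On the right, \<open>ennreal\<close>
  truncates negative weights to 0, and \<open>distr\<close> moves the point measure from the power
  set of \<open>S\<close> to the sigma-algebra of \<open>N\<close>, so that integrals become finite
  sums.\<close>

lemma upper_variation_discrete:
  assumes S: "finite S" "S \<subseteq> space N" "\<And>s. s \<in> S \<Longrightarrow> {s} \<in> sets N"
  shows "upper_variation N (discrete_measure S c) =
    distr (point_measure S (\<lambda>s. ennreal (c s))) N (\<lambda>s. s)"
proof (rule measure_eqI)
  fix A assume "A \<in> sets (upper_variation N (discrete_measure S c))"
  then have A: "A \<in> sets N" by simp
  \<comment> \<open>This makes the maximising set below an admissible competitor in the
    supremum.\<close>
  have fin: "B \<in> sets N" if "B \<subseteq> S" for B
  proof -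
    have "(\<Union>s\<in>B. {s}) \<in> sets N"
      using that S finite_subset by (intro sets.finite_UN) auto
    then show ?thesis by simp
  qed
  have "(SUP B \<in> {B \<in> sets N. B \<subseteq> A}. ennreal (discrete_measure S c B)) =
      (\<Sum>s\<in>S \<inter> A. ennreal (c s))" (is "?L = ?R")
  proof (rule antisym)
    show "?L \<le> ?R"
    proof (rule SUP_least)
      fix B assume B: "B \<in> {B \<in> sets N. B \<subseteq> A}"
      \<comment> \<open>Truncating the weights at 0 and then enlarging \<open>B\<close> to
        \<open>A\<close> can only increase the sum.\<close>
      have "discrete_measure S c B \<le> (\<Sum>s\<in>S. max 0 (c s) * indicator A s)"
        unfolding discrete_measure_def using B
        by (intro sum_mono) (auto simp: indicator_def)
      also have "\<dots> = (\<Sum>s\<in>S \<inter> A. max 0 (c s))"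
        unfolding sum.inter_restrict[OF S(1)] by (intro sum.cong) auto
      finally have "ennreal (discrete_measure S c B) \<le> ennreal (\<Sum>s\<in>S \<inter> A. max 0 (c s))"
        by (rule ennreal_leI)
      also have "\<dots> = (\<Sum>s\<in>S \<inter> A. ennreal (max 0 (c s)))"
        by (rule sum_ennreal[symmetric]) simp
      also have "\<dots> = ?R"
        by (intro sum.cong refl ennreal_max_zero)
      finally show "ennreal (discrete_measure S c B) \<le> ?R" .
    qed
  next
    \<comment> \<open>The maximiser: keeping exactly the positive weights loses nothing of the
      right-hand side.\<close>
    define B where "B = {s \<in> S \<inter> A. 0 < c s}"
    have "?R = (\<Sum>s\<in>B. ennreal (c s))"
      using S(1) by (intro sum.mono_neutral_right) (auto simp: B_def ennreal_eq_0_iff)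
    also have "\<dots> = ennreal (\<Sum>s\<in>B. c s)"
      by (rule sum_ennreal) (auto simp: B_def)
    also have "(\<Sum>s\<in>B. c s) = discrete_measure S c B"
      unfolding discrete_measure_def using S(1)
      by (intro sum.mono_neutral_cong_left) (auto simp: B_def)
    also have "ennreal \<dots> \<le> ?L"
      using fin[of B] by (intro SUP_upper) (auto simp: B_def)
    finally show "?R \<le> ?L" .
  qed
  moreover have "emeasure (distr (point_measure S (\<lambda>s. ennreal (c s))) N (\<lambda>s. s)) A = ?R"
    using A S by (subst emeasure_distr)
      (auto simp: space_point_measure emeasure_point_measure_finite Int_commute)
  ultimately show "emeasure (upper_variation N (discrete_measure S c)) A =
      emeasure (distr (point_measure S (\<lambda>s. ennreal (c s))) N (\<lambda>s. s)) A"
    using A by (simp add: emeasure_upper_variation finite_signed_measure_discrete)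
qed simp

text \<open>Negating the measure negates the weights, so the two variations carry the positive and
  negative parts of \<open>c\<close>, and \<open>max 0 (c s) - max 0 (- c s) = c s\<close>.\<close>

lemma signed_integral_discrete:
  assumes S: "finite S" "S \<subseteq> space N" "\<And>s. s \<in> S \<Longrightarrow> {s} \<in> sets N"
    and f: "f \<in> borel_measurable N"
  shows "signed_integral N (discrete_measure S c) f = (\<Sum>s\<in>S. c s * f s)"
proof -
  have upper: "(\<integral>x. f x \<partial>upper_variation N (discrete_measure S b)) = (\<Sum>s\<in>S. max 0 (b s) * f s)"
    for b
  proof -
    have m: "(\<lambda>s. s) \<in> point_measure S (\<lambda>s. ennreal (b s)) \<rightarrow>\<^sub>M N"
      using S(2) by auto
    \<comment> \<open>Writing the weights as \<open>max 0 (b s)\<close> leaves the measure unchanged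
      and supplies the nonnegativity needed to evaluate a Bochner integral over a point
      measure.\<close>
    have "(\<integral>x. f x \<partial>upper_variation N (discrete_measure S b)) =
        (\<integral>x. f x \<partial>point_measure S (\<lambda>s. ennreal (max 0 (b s))))"
      by (simp add: upper_variation_discrete[OF S] integral_distr[OF m f] ennreal_max_zero)
    also have "\<dots> = (\<Sum>s\<in>S. max 0 (b s) * f s)"
      using S(1) by (subst lebesgue_integral_point_measure_finite) auto
    finally show ?thesis .
  qed
  have "(\<lambda>A. - discrete_measure S c A) = discrete_measure S (\<lambda>s. - c s)"
    by (simp add: fun_eq_iff discrete_measure_def sum_negf)
  then show ?thesis
    unfolding signed_integral_def lower_variation_def
    by (auto simp: upper max_def simp flip: sum_subtractf intro!: sum.cong)
qed

context Metric_space
begin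

lemma space_metric_borel [simp]: "space (metric_borel M d) = M"
  by (simp add: metric_borel_def space_measure_of_conv)

lemma openin_metric_borel: "openin mtopology U \<Longrightarrow> U \<in> sets (metric_borel M d)"
  using openin_subset[of mtopology] unfolding metric_borel_def by (subst sets_measure_of) auto

lemma singleton_metric_borel:
  assumes "s \<in> M"
  shows "{s} \<in> sets (metric_borel M d)"
proof -
  have "openin mtopology (M - {s})"
    using closedin_Hausdorff_singleton[of mtopology s] Hausdorff_space_mtopology assms
    by (metis closedin_def topspace_mtopology)
  from sets.compl_sets[OF openin_metric_borel[OF this]] show ?thesis
    using assms by (simp add: double_diff)
qed

text \<open>The strict sublevel sets are open balls.\<close>

lemma measurable_dist_metric_borel:
  assumes "s \<in> M"
  shows "(\<lambda>x. d s x) \<in> borel_measurable (metric_borel M d)"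
  unfolding borel_measurable_iff_less
proof
  fix a
  have "{w \<in> space (metric_borel M d). d s w < a} = mball s a"
    using assms by auto
  then show "{w \<in> space (metric_borel M d). d s w < a} \<in> sets (metric_borel M d)"
    by (simp add: openin_metric_borel)
qed

text \<open>Both integrations collapse to finite sums by
  \<open>signed_integral_discrete\<close>.\<close>

lemma energy_discrete:
  assumes S: "finite S" "S \<subseteq> M"
  shows "energy M d (discrete_measure S c) = (\<Sum>s\<in>S. \<Sum>r\<in>S. c s * c r * d s r)"
proof -
  let ?N = "metric_borel M d"
  note integral = signed_integral_discrete[of S ?N, OF S(1)]
  have inner: "signed_integral ?N (discrete_measure S c) (\<lambda>x. d x y) = (\<Sum>s\<in>S. c s * d s y)"
    if "y \<in> M" for y
    using S(2) singleton_metric_borel measurable_dist_metric_borel[OF that]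
    by (subst integral) (auto simp: commute)
  have meas: "(\<lambda>y. \<Sum>s\<in>S. c s * d s y) \<in> borel_measurable ?N"
    using S(2) measurable_dist_metric_borel by (intro borel_measurable_sum borel_measurable_times) auto
  \<comment> \<open>The inner integral is known only for \<open>y\<close> in \<open>M\<close>; as
    both variations live on \<open>M\<close>, this suffices to rewrite under the outer
    integral.\<close>
  have sp: "space (upper_variation ?N \<mu>) = M" for \<mu>
    by (simp add: upper_variation_def space_measure_of_conv)
  have "energy M d (discrete_measure S c) =
      signed_integral ?N (discrete_measure S c) (\<lambda>y. \<Sum>s\<in>S. c s * d s y)"
    unfolding energy_def signed_integral_def[of _ _ "\<lambda>y. signed_integral _ _ (\<lambda>x. d x y)"]
      signed_integral_def[of _ _ "\<lambda>y. \<Sum>s\<in>S. c s * d s y"] lower_variation_def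
    by (intro arg_cong2[where f = "(-)"] Bochner_Integration.integral_cong refl)
      (simp_all add: sp inner)
  also have "\<dots> = (\<Sum>r\<in>S. c r * (\<Sum>s\<in>S. c s * d s r))"
    using S(2) singleton_metric_borel meas by (intro integral) auto
  also have "\<dots> = (\<Sum>s\<in>S. \<Sum>r\<in>S. c s * c r * d s r)"
    by (simp add: sum_distrib_left commute mult_ac)
  finally show ?thesis .
qed

end

text \<open>The points in the definition of \<open>quasihypermetric\<close> may repeat; merging their weights
  turns a violating family into weights on a finite set.\<close>

lemma not_quasihypermetricE:
  assumes "\<not> quasihypermetric X d"
  obtains S c where "finite S" "S \<subseteq> X" "(\<Sum>s\<in>S. c s) = 0"
    "(\<Sum>s\<in>S. \<Sum>r\<in>S. c s * c r * d s r) > 0"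
proof -
  from assms obtain n :: nat and \<alpha> :: "nat \<Rightarrow> real" and x where
    \<alpha>: "(\<Sum>i=1..n. \<alpha> i) = 0" and x: "\<forall>i\<in>{1..n}. x i \<in> X"
    and pos: "(\<Sum>i=1..n. \<Sum>j=1..n. \<alpha> i * \<alpha> j * d (x i) (x j)) > 0"
    unfolding quasihypermetric_def by (auto simp: not_le)
  define c where "c s = (\<Sum>i | i \<in> {1..n} \<and> x i = s. \<alpha> i)" for s
  \<comment> \<open>Grouping indices by the point they hit. A general \<open>g\<close> serves the
    inner sum, the outer sum and, with \<open>g\<close> constantly 1, the total mass.\<close>
  have merge: "(\<Sum>i=1..n. \<alpha> i * g (x i)) = (\<Sum>s\<in>x ` {1..n}. c s * g s)" for g
    unfolding c_def sum_distrib_right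
    by (subst sum.image_gen[where g = x]) (auto intro!: sum.cong)
  have "(\<Sum>i=1..n. \<Sum>j=1..n. \<alpha> i * \<alpha> j * d (x i) (x j)) =
      (\<Sum>i=1..n. \<alpha> i * (\<Sum>j=1..n. \<alpha> j * d (x i) (x j)))"
    by (simp add: sum_distrib_left mult.assoc)
  also have "\<dots> = (\<Sum>i=1..n. \<alpha> i * (\<Sum>r\<in>x ` {1..n}. c r * d (x i) r))"
    by (simp only: merge)
  also have "\<dots> = (\<Sum>s\<in>x ` {1..n}. c s * (\<Sum>r\<in>x ` {1..n}. c r * d s r))"
    by (rule merge)
  also have "\<dots> = (\<Sum>s\<in>x ` {1..n}. \<Sum>r\<in>x ` {1..n}. c s * c r * d s r)"
    by (simp add: sum_distrib_left mult.assoc)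
  finally have "(\<Sum>s\<in>x ` {1..n}. \<Sum>r\<in>x ` {1..n}. c s * c r * d s r) > 0"
    using pos by simp
  moreover have "(\<Sum>s\<in>x ` {1..n}. c s) = 0"
    using merge[of "\<lambda>_. 1"] \<alpha> by simp
  ultimately show thesis
    using x by (intro that[of "x ` {1..n}" c]) auto
qed

lemma quadratic_unbounded:
  fixes Q L K :: real
  assumes "Q > 0"
  obtains t where "K \<le> Q * t\<^sup>2 + L * t"
proof -
  \<comment> \<open>The second entry gives \<open>Q * t + L\<close> at least the absolute value of
    \<open>K\<close>; multiplying by \<open>t\<close>, which is at least 1, preserves this
    bound.\<close>
  define t where "t = max 1 ((\<bar>K\<bar> + \<bar>L\<bar>) / Q)"
  have t: "1 \<le> t" "\<bar>K\<bar> + \<bar>L\<bar> \<le> Q * t"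
    using assms by (auto simp: t_def field_simps max_def)
  have "K \<le> \<bar>K\<bar> * t"
    using t(1) mult_left_mono[of 1 t "\<bar>K\<bar>"] by simp
  also have "\<dots> \<le> (Q * t + L) * t"
    using t by (intro mult_right_mono) auto
  finally show thesis
    by (intro that[of t]) (simp add: power2_eq_square algebra_simps)
qed

theorem theorem3p1:
  fixes X :: "'a set" and d :: "'a \<Rightarrow> 'a \<Rightarrow> real"
  assumes "Metric_space X d"
    and "compact_space (Metric_space.mtopology X d)"
    and "\<not> quasihypermetric X d"
  shows "max_energy X d = \<infinity>"
proof (rule ereal_top)
  fix K :: real
  interpret Metric_space X d by fact
  obtain S c where S: "finite S" "S \<subseteq> X" and c: "(\<Sum>s\<in>S. c s) = 0"
    and pos: "(\<Sum>s\<in>S. \<Sum>r\<in>S. c s * c r * d s r) > 0" (is "?Q > 0")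
    using not_quasihypermetricE[OF assms(3)] .
  \<comment> \<open>If \<open>S\<close> were empty, the double sum would be 0.\<close>
  from pos obtain p where p: "p \<in> S" by fastforce
  define e :: "'a \<Rightarrow> real" where "e s = (if s = p then 1 else 0)" for s
  \<comment> \<open>With \<open>e\<close> the weights of the Dirac measure at \<open>p\<close>, this
    is the coefficient of \<open>t\<close> in the energy of \<open>t * c + e\<close>.\<close>
  define L where "L = (\<Sum>s\<in>S. \<Sum>r\<in>S. (c s * e r + e s * c r) * d s r)"
  obtain t where t: "K \<le> ?Q * t\<^sup>2 + L * t"
    using quadratic_unbounded[OF pos] .
  define \<mu> where "\<mu> = discrete_measure S (\<lambda>s. t * c s + e s)"
  \<comment> \<open>The constant term vanishes: only the pair \<open>p\<close>, \<open>p\<close> has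
    nonzero weight, and \<open>d p p = 0\<close>.\<close>
  have "(\<Sum>s\<in>S. \<Sum>r\<in>S. e s * e r * d s r) = 0"
    by (intro sum.neutral ballI) (use S p in \<open>auto simp: e_def\<close>)
  moreover have "energy X d \<mu> = ?Q * t\<^sup>2 + L * t + (\<Sum>s\<in>S. \<Sum>r\<in>S. e s * e r * d s r)"
    unfolding \<mu>_def energy_discrete[OF S] L_def
    by (simp add: sum_distrib_left sum.distrib power2_eq_square algebra_simps)
  ultimately have "ereal K \<le> ereal (energy X d \<mu>)"
    using t by simp
  moreover have "\<mu> X = 1"
  proof -
    have "\<mu> X = (\<Sum>s\<in>S. t * c s + e s)"
      unfolding \<mu>_def discrete_measure_def using S(2) by (intro sum.cong) auto
    then show ?thesis
      using S(1) p c by (simp add: sum.distrib e_def flip: sum_distrib_left)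
  qed
  then have "\<mu> \<in> unit_signed_measures X d"
    by (simp add: unit_signed_measures_def \<mu>_def finite_signed_measure_discrete)
  then have "ereal (energy X d \<mu>) \<le> max_energy X d"
    unfolding max_energy_def by (rule SUP_upper)
  ultimately show "ereal K \<le> max_energy X d" by (rule order_trans)
qed

end
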